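(* Let $n\ge 2$. On the semigroup $\mathcal{SS}'_n$, Green's relations satisfy $\mathcal{D}=\mathcal{L}$.
   Context: Let $[n]=\{1,2,\dots,n\}$ with its usual order. $\mathcal{P}_n$ is the semigroup of all partial transformations of $[n]$ (maps whose domain and image are subsets of $[n]$, including the empty map), composed from left to right: $x(\alpha\beta)=(x\alpha)\beta$. A partial map $\alpha$ is isotone if $x\le y$ implies $x\alpha\le y\alpha$ for all $x,y\in\mathrm{Dom}\,\alpha$, and order-decreasing if $x\alpha\le x$ for all $x\in\mathrm{Dom}\,\alpha$. $\mathcal{LS}_n$ is the monoid of all isotone order-decreasing $\alpha\in\mathcal{P}_n$, and $\mathcal{SS}'_n=\{\alpha\in\mathcal{LS}_n: 1\notin \mathrm{Dom}\,\alpha\}$, a subsemigroup of $\mathcal{LS}_n$. For a semigroup $S$, $S^1$ is $S$ with an identity adjoined if necessary; $a\,\mathcal{L}\,b$ iff $S^1a=S^1b$, $a\,\mathcal{R}\,b$ iff $aS^1=bS^1$, and $\mathcal{D}$ is the join of $\mathcal{L}$ and $\mathcal{R}$ (the smallest equivalence relation containing both). *)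

theory Defs
  imports Main
begin

section \<open>Partial transformations of the chain [n]\<close>

definition PT :: "nat \<Rightarrow> (nat \<rightharpoonup> nat) set" where
  "PT n = {\<alpha>. dom \<alpha> \<subseteq> {1..n} \<and> ran \<alpha> \<subseteq> {1..n}}"

(* Composition is from left to right, the opposite of map_comp:
   x(\<alpha>\<beta>) = (x\<alpha>)\<beta>. *)
definition pt_mult :: "(nat \<rightharpoonup> nat) \<Rightarrow> (nat \<rightharpoonup> nat) \<Rightarrow> (nat \<rightharpoonup> nat)" where
  "pt_mult \<alpha> \<beta> = \<beta> \<circ>\<^sub>m \<alpha>"

definition isotone :: "(nat \<rightharpoonup> nat) \<Rightarrow> bool" where
  "isotone \<alpha> \<longleftrightarrow>
     (\<forall>x\<in>dom \<alpha>. \<forall>y\<in>dom \<alpha>. x \<le> y \<longrightarrow> the (\<alpha> x) \<le> the (\<alpha> y))"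

definition order_decreasing :: "(nat \<rightharpoonup> nat) \<Rightarrow> bool" where
  "order_decreasing \<alpha> \<longleftrightarrow> (\<forall>x\<in>dom \<alpha>. the (\<alpha> x) \<le> x)"

definition LS :: "nat \<Rightarrow> (nat \<rightharpoonup> nat) set" where
  "LS n = {\<alpha> \<in> PT n. isotone \<alpha> \<and> order_decreasing \<alpha>}"

definition SS' :: "nat \<Rightarrow> (nat \<rightharpoonup> nat) set" where
  "SS' n = {\<alpha> \<in> LS n. 1 \<notin> dom \<alpha>}"


section \<open>Green's relations of a semigroup given by a carrier and a multiplication\<close>

definition has_identity :: "'a set \<Rightarrow> ('a \<Rightarrow> 'a \<Rightarrow> 'a) \<Rightarrow> bool" where
  "has_identity S f \<longleftrightarrow> (\<exists>e\<in>S. \<forall>s\<in>S. f e s = s \<and> f s e = s)"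

(* The monoid S^1 lives in the option type: Some s is the element s of S,
   and None is the adjoined identity, present only if S has no identity. *)
definition adj_one :: "'a set \<Rightarrow> ('a \<Rightarrow> 'a \<Rightarrow> 'a) \<Rightarrow> 'a option set" where
  "adj_one S f = (if has_identity S f then Some ` S else insert None (Some ` S))"

fun adj_mult :: "('a \<Rightarrow> 'a \<Rightarrow> 'a) \<Rightarrow> 'a option \<Rightarrow> 'a option \<Rightarrow> 'a option" where
  "adj_mult f None y = y"
| "adj_mult f (Some a) None = Some a"
| "adj_mult f (Some a) (Some b) = Some (f a b)"

definition left_ideal :: "'a set \<Rightarrow> ('a \<Rightarrow> 'a \<Rightarrow> 'a) \<Rightarrow> 'a \<Rightarrow> 'a option set" where
  "left_ideal S f a = {adj_mult f s (Some a) | s. s \<in> adj_one S f}"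

definition right_ideal :: "'a set \<Rightarrow> ('a \<Rightarrow> 'a \<Rightarrow> 'a) \<Rightarrow> 'a \<Rightarrow> 'a option set" where
  "right_ideal S f a = {adj_mult f (Some a) s | s. s \<in> adj_one S f}"

definition green_L :: "'a set \<Rightarrow> ('a \<Rightarrow> 'a \<Rightarrow> 'a) \<Rightarrow> ('a \<times> 'a) set" where
  "green_L S f = {(a, b). a \<in> S \<and> b \<in> S \<and> left_ideal S f a = left_ideal S f b}"

definition green_R :: "'a set \<Rightarrow> ('a \<Rightarrow> 'a \<Rightarrow> 'a) \<Rightarrow> ('a \<times> 'a) set" where
  "green_R S f = {(a, b). a \<in> S \<and> b \<in> S \<and> right_ideal S f a = right_ideal S f b}"

definition green_D :: "'a set \<Rightarrow> ('a \<Rightarrow> 'a \<Rightarrow> 'a) \<Rightarrow> ('a \<times> 'a) set" where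
  "green_D S f = \<Inter> {r. equiv S r \<and> green_L S f \<subseteq> r \<and> green_R S f \<subseteq> r}"


section \<open>\<open>SS' n\<close> is a semigroup\<close>

lemma pt_mult_assoc: "pt_mult (pt_mult \<alpha> \<beta>) \<gamma> = pt_mult \<alpha> (pt_mult \<beta> \<gamma>)"
  by (auto simp: pt_mult_def map_comp_def fun_eq_iff split: option.splits)

lemma pt_mult_closed:
  assumes a: "\<alpha> \<in> SS' n" and b: "\<beta> \<in> SS' n"
  shows "pt_mult \<alpha> \<beta> \<in> SS' n"
proof -
  let ?g = "pt_mult \<alpha> \<beta>"
  have D: "\<exists>y. \<alpha> x = Some y \<and> \<beta> y = Some z" if "?g x = Some z" for x z
    using that by (auto simp: pt_mult_def map_comp_Some_iff)
  have "dom ?g \<subseteq> dom \<alpha>" "ran ?g \<subseteq> ran \<beta>"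
    by (auto simp: ran_def dest!: D)
  then have "?g \<in> PT n" "1 \<notin> dom ?g"
    using a b by (auto simp: SS'_def LS_def PT_def)
  moreover have "isotone ?g"
    unfolding isotone_def
  proof (intro ballI impI)
    fix x y assume "x \<in> dom ?g" "y \<in> dom ?g" and le: "x \<le> y"
    then obtain u v u' v' where *: "?g x = Some v" "?g y = Some v'"
      "\<alpha> x = Some u" "\<beta> u = Some v" "\<alpha> y = Some u'" "\<beta> u' = Some v'"
      using D by blast
    have "isotone \<alpha>" "isotone \<beta>" using a b by (auto simp: SS'_def LS_def)
    then have "u \<le> u'" "u \<le> u' \<longrightarrow> v \<le> v'"
      using * le unfolding isotone_def by (metis domI option.sel)+
    then show "the (?g x) \<le> the (?g y)" using * by simp
  qed
  moreover have "order_decreasing ?g"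
    unfolding order_decreasing_def
  proof
    fix x assume "x \<in> dom ?g"
    then obtain u v where *: "?g x = Some v" "\<alpha> x = Some u" "\<beta> u = Some v"
      using D by blast
    have "order_decreasing \<alpha>" "order_decreasing \<beta>" using a b by (auto simp: SS'_def LS_def)
    then have "u \<le> x" "v \<le> u"
      using * unfolding order_decreasing_def by (metis domI option.sel)+
    then show "the (?g x) \<le> x" using * by simp
  qed
  ultimately show ?thesis by (simp add: SS'_def LS_def)
qed

end

theory Submission
  imports Defs
begin

text \<open>
  Right multiplication by an order-decreasing map can only shrink the domain and lower the
  values. Hence two elements that are right multiples of each other coincide, so
  \<open>\<R>\<close> is trivial and the join of \<open>\<L>\<close> and \<open>\<R>\<close> is
  \<open>\<L>\<close>.
\<close>

lemma equiv_green_L: "equiv S (green_L S f)"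
  by (rule equivI) (auto simp: green_L_def refl_on_def sym_def trans_def)

text \<open>As \<open>green_L S f\<close> is reflexive on \<open>S\<close>, it absorbs a trivial
  \<open>green_R S f\<close>. It is then one of the equivalences intersected in
  \<open>green_D\<close>, and it lies in all the others.\<close>

lemma green_D_eq_green_L:
  assumes "green_R S f \<subseteq> Id"
  shows "green_D S f = green_L S f"
proof -
  have "green_R S f \<subseteq> green_L S f"
    using assms by (auto simp: green_R_def green_L_def)
  then show ?thesis
    using equiv_green_L[of S f] unfolding green_D_def by blast
qed

lemma self_in_right_ideal:
  assumes "a \<in> S"
  shows "Some a \<in> right_ideal S f a"
proof (cases "has_identity S f")
  case True
  then obtain e where "e \<in> S" "f a e = a"
    using assms unfolding has_identity_def by blast
  then have "Some e \<in> adj_one S f" "Some a = adj_mult f (Some a) (Some e)"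
    using True by (simp_all add: adj_one_def)
  then show ?thesis unfolding right_ideal_def by blast
next
  case False
  then have "None \<in> adj_one S f" "Some a = adj_mult f (Some a) None"
    by (simp_all add: adj_one_def)
  then show ?thesis unfolding right_ideal_def by blast
qed

text \<open>The case \<open>a = b\<close> comes from multiplying by the adjoined identity
  \<open>None\<close>, the other from a factor \<open>Some c\<close>.\<close>

lemma green_R_cases:
  assumes "(a, b) \<in> green_R S f"
  shows "a = b \<or> (\<exists>c\<in>S. a = f b c)"
proof -
  have "Some a \<in> right_ideal S f b"
    using assms self_in_right_ideal[of a S f] by (auto simp: green_R_def)
  then show ?thesis
    by (auto simp: right_ideal_def adj_one_def split: if_splits)
qed

lemma green_R_sym: "(a, b) \<in> green_R S f \<Longrightarrow> (b, a) \<in> green_R S f"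
  by (simp add: green_R_def)

lemma pt_mult_order_decreasing:
  assumes "order_decreasing \<gamma>" "pt_mult \<beta> \<gamma> x = Some y"
  shows "\<exists>z\<ge>y. \<beta> x = Some z"
proof -
  obtain z where z: "\<beta> x = Some z" "\<gamma> z = Some y"
    using assms(2) by (auto simp: pt_mult_def map_comp_Some_iff)
  then have "y \<le> z"
    using assms(1) unfolding order_decreasing_def by (metis domI option.sel)
  then show ?thesis using z by blast
qed

text \<open>One-sided comparison, covering domain and values at once; symmetry of \<R> supplies the
  reverse.\<close>

lemma green_R_SS'_ge:
  assumes "(\<alpha>, \<beta>) \<in> green_R (SS' n) pt_mult" "\<alpha> x = Some y"
  shows "\<exists>z\<ge>y. \<beta> x = Some z"
  using green_R_cases[OF assms(1)] assms(2) pt_mult_order_decreasing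
  by (auto simp: SS'_def LS_def)

lemma green_R_SS'_trivial: "green_R (SS' n) pt_mult \<subseteq> Id"
proof clarify
  fix \<alpha> \<beta> assume R: "(\<alpha>, \<beta>) \<in> green_R (SS' n) pt_mult"
  note ge = green_R_SS'_ge[OF R] green_R_SS'_ge[OF green_R_sym[OF R]]
  \<comment> \<open>By \<open>ge\<close>, both maps are defined at \<open>x\<close> or neither is;
    where defined, antisymmetry of \<le> equates the values.\<close>
  have "\<alpha> x = \<beta> x" for x
    using ge[of x] by (cases "\<alpha> x"; cases "\<beta> x") fastforce+
  then show "\<alpha> = \<beta>" ..
qed

theorem theorem2p5:
  fixes n :: nat
  assumes "n \<ge> 2"
  shows "green_D (SS' n) pt_mult = green_L (SS' n) pt_mult"
  by (rule green_D_eq_green_L[OF green_R_SS'_trivial])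

end
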